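(* Let $m,n\ge2$ and let $(S,T)$ be an irreducible Cuntz-type atomic representation of type 1 of a single vertex $2$-graph $\mathbb{F}_\theta^+$, with minimal finite dimensional coinvariant cyclic subspace $\mathcal{V}$. Suppose there is a standard basis vector $\eta\in\mathcal{V}^\perp$ such that either $\langle S_u\eta,\eta\rangle\ne0$ for some nonempty word $u\in\mathbb{F}_m^+$, or $\langle T_v\eta,\eta\rangle\ne0$ for some nonempty word $v\in\mathbb{F}_n^+$. Then there is a standard basis vector which is wandering for $(S,T)$.
   Context: Single vertex $2$-graph: for positive integers $m,n$ and a permutation $\theta$ of $\{1,\ldots,m\}\times\{1,\ldots,n\}$, $\mathbb{F}_\theta^+$ is the unital cancellative semigroup generated by $e_1,\ldots,e_m,f_1,\ldots,f_n$, where the $e_i$ generate a copy of the free semigroup $\mathbb{F}_m^+$, the $f_j$ generate a copy of $\mathbb{F}_n^+$, and $e_if_j=f_{j'}e_{i'}$ whenever $\theta(i,j)=(i',j')$. Every $w\in\mathbb{F}_\theta^+$ is uniquely $w=e_uf_v$. A Cuntz-type representation $(S,T)$ on a Hilbert space $\mathcal{H}$ consists of $S=[S_1,\ldots,S_m]$, $T=[T_1,\ldots,T_n]$ with $S_i^*S_j=\delta_{i,j}I$, $T_k^*T_l=\delta_{k,l}I$, $\sum_iS_iS_i^*=I=\sum_jT_jT_j^*$, and $S_iT_j=T_{j'}S_{i'}$ whenever $\theta(i,j)=(i',j')$. For $w=e_uf_v$, $(ST)_w=S_uT_v$. It is irreducible if it has no nontrivial closed reducing subspace. A representation is atomic if there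 is an orthonormal basis $\{\xi_k:k\ge0\}$ of $\mathcal{H}$ (the standard basis) such that each $(ST)_w$ maps each basis vector to a scalar in $\mathbb{T}\cup\{0\}$ times a basis vector. Write $\overline{\xi}=\{\lambda\xi:\lambda\in\mathbb{T}\}$. The graph of the representation has vertices $\overline{\xi_k}$, a blue edge from $\overline{\xi_i}$ to $\overline{\xi_j}$ if some $S_p\overline{\xi_i}=\overline{\xi_j}$, and a red edge if some $T_q\overline{\xi_i}=\overline{\xi_j}$. In the Cuntz-type case each vertex has exactly one blue and one red edge leading into it. $S$ is of ring type if every connected component of the blue graph contains a directed cycle; similarly for $T$ with the red graph. Type 1: both $S$ and $T$ are of ring type. In this case there are a standard basis vector $\xi$ and nonempty words $u_0\in\mathbb{F}_m^+$, $v_0\in\mathbb{F}_n^+$ with $S_{u_0}\overline{\xi}=\overline{\xi}=T_{v_0}\overline{\xi}$, and $\mathcal{V}$ is the smallest coinvariant subspace containing $\xi$; it is finite dimensional, spanned by standard basis vectors, and cyclic. Coinvariant means invariant under all $S_i^*,T_j^*$; cyclic means that $\bigvee_{w\in\mathbb{F}_\theta^+}(ST)_w\mathcal{V}=\mathcal{H}$. A unit vector $\zeta\in\mathcal{H}$ is wandering for $(S,T)$ if $\langle(ST)_u\zeta,(ST)_w\zeta\rangle=\delta_{u,w}$ for all $u,w\in\mathbb{F}_\theta^+$. *)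

theory Defs
  imports "HOL-Analysis.Analysis" "HOL-Combinatorics.Permutations"
begin

section \<open>Complex Hilbert spaces\<close>

text \<open>The inner product is linear in the first argument. Completeness comes from \<^class>\<open>banach\<close>.\<close>

class complex_hilbert = banach +
  fixes scaleC :: "complex \<Rightarrow> 'a \<Rightarrow> 'a"  (infixr \<open>*\<^sub>C\<close> 75)
    and cinner :: "'a \<Rightarrow> 'a \<Rightarrow> complex"
  assumes scaleC_add_right: "c *\<^sub>C (x + y) = c *\<^sub>C x + c *\<^sub>C y"
    and scaleC_add_left: "(c + d) *\<^sub>C x = c *\<^sub>C x + d *\<^sub>C x"
    and scaleC_scaleC: "c *\<^sub>C (d *\<^sub>C x) = (c * d) *\<^sub>C x"
    and scaleC_one: "1 *\<^sub>C x = x"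
    and scaleR_eq_scaleC: "r *\<^sub>R x = complex_of_real r *\<^sub>C x"
    and cinner_commute: "cinner x y = cnj (cinner y x)"
    and cinner_add_left: "cinner (x + y) z = cinner x z + cinner y z"
    and cinner_scaleC_left: "cinner (c *\<^sub>C x) y = c * cinner x y"
    and norm_eq_sqrt_cinner: "norm x = sqrt (Re (cinner x x))"

global_interpretation complex_vector:
  vector_space "scaleC :: complex \<Rightarrow> 'a \<Rightarrow> 'a::complex_hilbert"
  defines csubspace = complex_vector.subspace
    and cspan = complex_vector.span
  by unfold_locales
    (simp_all add: scaleC_add_right scaleC_add_left scaleC_scaleC scaleC_one)

definition bounded_clinear :: "('a::complex_hilbert \<Rightarrow> 'a) \<Rightarrow> bool" where
  "bounded_clinear A \<longleftrightarrow> bounded_linear A \<and> (\<forall>c x. A (c *\<^sub>C x) = c *\<^sub>C A x)"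

text \<open>Meaningful for bounded complex linear \<open>A\<close>, where the adjoint exists and is unique.\<close>

definition cadjoint :: "('a::complex_hilbert \<Rightarrow> 'a) \<Rightarrow> 'a \<Rightarrow> 'a" where
  "cadjoint A = (SOME B. \<forall>x y. cinner (A x) y = cinner x (B y))"

definition orth_complement :: "'a::complex_hilbert set \<Rightarrow> 'a set" where
  "orth_complement V = {x. \<forall>v\<in>V. cinner x v = 0}"

definition orthonormal_basis :: "(nat \<Rightarrow> 'a::complex_hilbert) \<Rightarrow> bool" where
  "orthonormal_basis \<xi> \<longleftrightarrow>
     (\<forall>i j. cinner (\<xi> i) (\<xi> j) = (if i = j then 1 else 0)) \<and>
     closure (cspan (range \<xi>)) = UNIV"


section \<open>The semigroup of a single vertex 2-graph\<close>

text \<open>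
  The semigroup is given by its presentation: words in the generators \<open>e\<^sub>i\<close>, \<open>f\<^sub>j\<close>
  modulo the congruence generated by \<open>e\<^sub>i f\<^sub>j = f\<^sub>j\<^sub>' e\<^sub>i\<^sub>'\<close> for \<open>\<theta>(i,j) = (i',j')\<close>.
  Its elements are the congruence classes.
\<close>

datatype generator = Gen_e nat | Gen_f nat

definition gen_words :: "nat \<Rightarrow> nat \<Rightarrow> generator list set" where
  "gen_words m n = lists (Gen_e ` {1..m} \<union> Gen_f ` {1..n})"

definition theta_step ::
  "nat \<Rightarrow> nat \<Rightarrow> (nat \<times> nat \<Rightarrow> nat \<times> nat) \<Rightarrow> (generator list \<times> generator list) set" where
  "theta_step m n \<theta> =
     {(x @ [Gen_e i, Gen_f j] @ y, x @ [Gen_f j', Gen_e i'] @ y) | x y i j i' j'.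
        x \<in> gen_words m n \<and> y \<in> gen_words m n \<and>
        i \<in> {1..m} \<and> j \<in> {1..n} \<and> \<theta> (i, j) = (i', j')}"

definition theta_cong ::
  "nat \<Rightarrow> nat \<Rightarrow> (nat \<times> nat \<Rightarrow> nat \<times> nat) \<Rightarrow> (generator list \<times> generator list) set" where
  "theta_cong m n \<theta> = (theta_step m n \<theta> \<union> (theta_step m n \<theta>)\<inverse>)\<^sup>*"

definition theta_semigroup ::
  "nat \<Rightarrow> nat \<Rightarrow> (nat \<times> nat \<Rightarrow> nat \<times> nat) \<Rightarrow> generator list set set" where
  "theta_semigroup m n \<theta> = gen_words m n // theta_cong m n \<theta>"


section \<open>Cuntz-type representations\<close>

definition word_op :: "(nat \<Rightarrow> 'a \<Rightarrow> 'a) \<Rightarrow> nat list \<Rightarrow> 'a \<Rightarrow> 'a" where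
  "word_op S u = foldr (\<lambda>i A. S i \<circ> A) u id"

text \<open>\<open>(ST)\<^sub>w = S\<^sub>u T\<^sub>v\<close> for the factorisation \<open>w = e\<^sub>u f\<^sub>v\<close>; here \<open>w\<close> is a congruence class.\<close>

definition ST_op ::
  "nat \<Rightarrow> nat \<Rightarrow> (nat \<Rightarrow> 'a \<Rightarrow> 'a) \<Rightarrow> (nat \<Rightarrow> 'a \<Rightarrow> 'a) \<Rightarrow> generator list set \<Rightarrow> 'a \<Rightarrow> 'a" where
  "ST_op m n S T w =
     (THE A. \<exists>u\<in>lists {1..m}. \<exists>v\<in>lists {1..n}.
        map Gen_e u @ map Gen_f v \<in> w \<and> A = word_op S u \<circ> word_op T v)"

definition cuntz_family :: "nat \<Rightarrow> (nat \<Rightarrow> 'a::complex_hilbert \<Rightarrow> 'a) \<Rightarrow> bool" where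
  "cuntz_family m S \<longleftrightarrow>
     (\<forall>i\<in>{1..m}. bounded_clinear (S i)) \<and>
     (\<forall>i\<in>{1..m}. \<forall>j\<in>{1..m}. \<forall>x. cadjoint (S i) (S j x) = (if i = j then x else 0)) \<and>
     (\<forall>x. (\<Sum>i\<in>{1..m}. S i (cadjoint (S i) x)) = x)"

definition cuntz_type_rep ::
  "nat \<Rightarrow> nat \<Rightarrow> (nat \<times> nat \<Rightarrow> nat \<times> nat) \<Rightarrow>
   (nat \<Rightarrow> 'a::complex_hilbert \<Rightarrow> 'a) \<Rightarrow> (nat \<Rightarrow> 'a \<Rightarrow> 'a) \<Rightarrow> bool" where
  "cuntz_type_rep m n \<theta> S T \<longleftrightarrow>
     cuntz_family m S \<and> cuntz_family n T \<and>
     (\<forall>i\<in>{1..m}. \<forall>j\<in>{1..n}. \<forall>i' j'. \<theta> (i, j) = (i', j') \<longrightarrow> S i \<circ> T j = T j' \<circ> S i')"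

definition coinvariant ::
  "nat \<Rightarrow> nat \<Rightarrow> (nat \<Rightarrow> 'a::complex_hilbert \<Rightarrow> 'a) \<Rightarrow> (nat \<Rightarrow> 'a \<Rightarrow> 'a) \<Rightarrow> 'a set \<Rightarrow> bool" where
  "coinvariant m n S T M \<longleftrightarrow>
     (\<forall>i\<in>{1..m}. cadjoint (S i) ` M \<subseteq> M) \<and> (\<forall>j\<in>{1..n}. cadjoint (T j) ` M \<subseteq> M)"

definition reducing ::
  "nat \<Rightarrow> nat \<Rightarrow> (nat \<Rightarrow> 'a::complex_hilbert \<Rightarrow> 'a) \<Rightarrow> (nat \<Rightarrow> 'a \<Rightarrow> 'a) \<Rightarrow> 'a set \<Rightarrow> bool" where
  "reducing m n S T M \<longleftrightarrow>
     (\<forall>i\<in>{1..m}. S i ` M \<subseteq> M) \<and> (\<forall>j\<in>{1..n}. T j ` M \<subseteq> M) \<and> coinvariant m n S T M"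

definition irreducible_rep ::
  "nat \<Rightarrow> nat \<Rightarrow> (nat \<Rightarrow> 'a::complex_hilbert \<Rightarrow> 'a) \<Rightarrow> (nat \<Rightarrow> 'a \<Rightarrow> 'a) \<Rightarrow> bool" where
  "irreducible_rep m n S T \<longleftrightarrow>
     (\<forall>M. csubspace M \<and> closed M \<and> reducing m n S T M \<longrightarrow> M = {0} \<or> M = UNIV)"

definition cyclic ::
  "nat \<Rightarrow> nat \<Rightarrow> (nat \<times> nat \<Rightarrow> nat \<times> nat) \<Rightarrow>
   (nat \<Rightarrow> 'a::complex_hilbert \<Rightarrow> 'a) \<Rightarrow> (nat \<Rightarrow> 'a \<Rightarrow> 'a) \<Rightarrow> 'a set \<Rightarrow> bool" where
  "cyclic m n \<theta> S T V \<longleftrightarrow>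
     closure (cspan (\<Union>w\<in>theta_semigroup m n \<theta>. ST_op m n S T w ` V)) = UNIV"

definition wandering ::
  "nat \<Rightarrow> nat \<Rightarrow> (nat \<times> nat \<Rightarrow> nat \<times> nat) \<Rightarrow>
   (nat \<Rightarrow> 'a::complex_hilbert \<Rightarrow> 'a) \<Rightarrow> (nat \<Rightarrow> 'a \<Rightarrow> 'a) \<Rightarrow> 'a \<Rightarrow> bool" where
  "wandering m n \<theta> S T \<zeta> \<longleftrightarrow>
     norm \<zeta> = 1 \<and>
     (\<forall>u\<in>theta_semigroup m n \<theta>. \<forall>w\<in>theta_semigroup m n \<theta>.
        cinner (ST_op m n S T u \<zeta>) (ST_op m n S T w \<zeta>) = (if u = w then 1 else 0))"


section \<open>Atomic representations and their graphs\<close>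

definition atomic_rep ::
  "nat \<Rightarrow> nat \<Rightarrow> (nat \<times> nat \<Rightarrow> nat \<times> nat) \<Rightarrow>
   (nat \<Rightarrow> 'a::complex_hilbert \<Rightarrow> 'a) \<Rightarrow> (nat \<Rightarrow> 'a \<Rightarrow> 'a) \<Rightarrow> (nat \<Rightarrow> 'a) \<Rightarrow> bool" where
  "atomic_rep m n \<theta> S T \<xi> \<longleftrightarrow>
     orthonormal_basis \<xi> \<and>
     (\<forall>w\<in>theta_semigroup m n \<theta>. \<forall>k. \<exists>c l.
        (norm c = 1 \<or> c = 0) \<and> ST_op m n S T w (\<xi> k) = c *\<^sub>C \<xi> l)"

definition ray :: "'a::complex_hilbert \<Rightarrow> 'a set" where
  "ray x = {c *\<^sub>C x | c. norm c = 1}"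

definition graph_vertices :: "(nat \<Rightarrow> 'a::complex_hilbert) \<Rightarrow> 'a set set" where
  "graph_vertices \<xi> = range (\<lambda>k. ray (\<xi> k))"

text \<open>For \<open>graph_edges m S \<xi>\<close> these are the blue edges, for \<open>graph_edges n T \<xi>\<close> the red ones.\<close>

definition graph_edges ::
  "nat \<Rightarrow> (nat \<Rightarrow> 'a::complex_hilbert \<Rightarrow> 'a) \<Rightarrow> (nat \<Rightarrow> 'a) \<Rightarrow> ('a set \<times> 'a set) set" where
  "graph_edges m S \<xi> =
     {(x, y). x \<in> graph_vertices \<xi> \<and> y \<in> graph_vertices \<xi> \<and> (\<exists>p\<in>{1..m}. S p ` x = y)}"

text \<open>Connectedness ignores the direction of edges; a loop counts as a directed cycle.\<close>

definition ring_type ::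
  "nat \<Rightarrow> (nat \<Rightarrow> 'a::complex_hilbert \<Rightarrow> 'a) \<Rightarrow> (nat \<Rightarrow> 'a) \<Rightarrow> bool" where
  "ring_type m S \<xi> \<longleftrightarrow>
     (let E = graph_edges m S \<xi> in
       \<forall>C \<in> graph_vertices \<xi> // (E \<union> E\<inverse>)\<^sup>*. \<not> acyclic (E \<inter> C \<times> C))"

definition type_1 ::
  "nat \<Rightarrow> nat \<Rightarrow> (nat \<Rightarrow> 'a::complex_hilbert \<Rightarrow> 'a) \<Rightarrow> (nat \<Rightarrow> 'a \<Rightarrow> 'a) \<Rightarrow> (nat \<Rightarrow> 'a) \<Rightarrow> bool" where
  "type_1 m n S T \<xi> \<longleftrightarrow> ring_type m S \<xi> \<and> ring_type n T \<xi>"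

text \<open>
  The space \<open>V\<close> attached to a type 1 representation: the smallest coinvariant subspace
  containing a standard basis vector fixed, up to scalars, by nonempty words of both colours.
\<close>

definition minimal_coinvariant_cyclic ::
  "nat \<Rightarrow> nat \<Rightarrow> (nat \<times> nat \<Rightarrow> nat \<times> nat) \<Rightarrow>
   (nat \<Rightarrow> 'a::complex_hilbert \<Rightarrow> 'a) \<Rightarrow> (nat \<Rightarrow> 'a \<Rightarrow> 'a) \<Rightarrow> (nat \<Rightarrow> 'a) \<Rightarrow> 'a set \<Rightarrow> bool" where
  "minimal_coinvariant_cyclic m n \<theta> S T \<xi> V \<longleftrightarrow>
     (\<exists>x\<in>range \<xi>. \<exists>u\<^sub>0\<in>lists {1..m}. \<exists>v\<^sub>0\<in>lists {1..n}.
        u\<^sub>0 \<noteq> [] \<and> v\<^sub>0 \<noteq> [] \<and>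
        word_op S u\<^sub>0 ` ray x = ray x \<and> word_op T v\<^sub>0 ` ray x = ray x \<and>
        V = (\<lambda>M. csubspace M \<and> coinvariant m n S T M) hull {x}) \<and>
     (\<exists>B. finite B \<and> V = cspan B) \<and>
     cyclic m n \<theta> S T V"

end

theory Submission
  imports Defs
begin

text \<open>
  Up to scalars the representation is a pair of commuting maps \<open>a\<close>, \<open>b\<close> on the index set of the
  basis, following the unique blue and the unique red edge backwards. By irreducibility every
  vertex is carried into the vertices \<open>L\<close> of \<open>V\<close> by some \<open>a\<^sup>c b\<^sup>d\<close>. Say that \<open>\<eta>\<close> lies on a blue cycle
  outside \<open>L\<close>; no power of \<open>b\<close> returns to this cycle, as \<open>\<eta>\<close> would then end up in \<open>L\<close>. Since
  \<open>m \<ge> 2\<close> there is a vertex \<open>z\<close> off the cycle with \<open>a z = \<eta>\<close>, and for this \<open>z\<close> neither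
  \<open>a\<^sup>p b\<^sup>q z = z\<close> nor \<open>a\<^sup>p z = b\<^sup>q z\<close> is possible unless \<open>p = q = 0\<close>. Cancelling common prefixes in
  \<open>e\<^sub>u f\<^sub>v z = e\<^sub>u\<^sub>' f\<^sub>v\<^sub>' z\<close> leads to one of these two equations, which forces \<open>u = u'\<close> and \<open>v = v'\<close>;
  hence \<open>z\<close> is wandering.
\<close>

section \<open>Inner products and orthonormal bases\<close>

lemma cinner_zero_left [simp]: "cinner 0 (y::'a::complex_hilbert) = 0"
  using cinner_add_left[of 0 0 y] by simp

lemma cinner_add_right: "cinner (x::'a::complex_hilbert) (y + z) = cinner x y + cinner x z"
  by (metis cinner_add_left cinner_commute complex_cnj_add)

lemma cinner_scaleC_right: "cinner (x::'a::complex_hilbert) (c *\<^sub>C y) = cnj c * cinner x y"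
  by (metis cinner_scaleC_left cinner_commute complex_cnj_mult)

lemma cinner_sum_left: "cinner (\<Sum>i\<in>A. f i) (y::'a::complex_hilbert) = (\<Sum>i\<in>A. cinner (f i) y)"
  by (induction A rule: infinite_finite_induct) (simp_all add: cinner_add_left)

lemma Re_cinner_self_nonneg: "Re (cinner (x::'a::complex_hilbert) x) \<ge> 0"
  using norm_ge_zero[of x] unfolding norm_eq_sqrt_cinner by simp

text \<open>Cauchy-Schwarz against a unit vector: with \<open>c = cinner x e\<close>, the vector
  \<open>x + (- c) *\<^sub>C e\<close> has squared norm \<open>cinner x x - c * cnj c\<close>, which
  is nonnegative.\<close>

lemma norm_cinner_unit_le:
  fixes x e :: "'a::complex_hilbert"
  assumes "cinner e e = 1"
  shows "norm (cinner x e) \<le> norm x"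
proof -
  define c where "c = cinner x e"
  have "cinner e x = cnj c"
    unfolding c_def by (rule cinner_commute)
  then have "cinner (x + d *\<^sub>C e) (x + d *\<^sub>C e) = cinner x x + cnj d * c + d * cnj c + d * cnj d" for d
    using assms by (simp add: cinner_add_left cinner_add_right cinner_scaleC_left
        cinner_scaleC_right c_def[symmetric] algebra_simps)
  from this[of "- c"] have "cinner (x + (- c) *\<^sub>C e) (x + (- c) *\<^sub>C e) = cinner x x - c * cnj c"
    by (simp add: algebra_simps)
  with Re_cinner_self_nonneg[of "x + (- c) *\<^sub>C e"] have "Re (c * cnj c) \<le> Re (cinner x x)"
    by (metis diff_ge_0_iff_ge minus_complex.simps(1))
  then have "(norm c)\<^sup>2 \<le> Re (cinner x x)"
    by (simp add: complex_norm_square[symmetric])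
  then show ?thesis
    unfolding c_def norm_eq_sqrt_cinner[of x] by (simp add: real_le_rsqrt)
qed

lemma bounded_linear_cinner_unit:
  fixes e :: "'a::complex_hilbert"
  assumes "cinner e e = 1"
  shows "bounded_linear (\<lambda>x. cinner x e)"
proof (rule bounded_linear_intro[where K = 1])
  show "cinner (r *\<^sub>R x) e = r *\<^sub>R cinner x e" for r x
    unfolding scaleR_eq_scaleC cinner_scaleC_left by (simp add: scaleR_conv_of_real)
qed (use norm_cinner_unit_le[OF assms] in \<open>simp_all add: cinner_add_left\<close>)

lemma cinner_basis:
  "orthonormal_basis \<xi> \<Longrightarrow> cinner (\<xi> k) (\<xi> l) = (if k = l then 1 else 0)"
  by (simp add: orthonormal_basis_def)

lemma scaleC_basis_eq_iff:
  assumes "orthonormal_basis \<xi>" "c \<noteq> 0" "c *\<^sub>C \<xi> k = d *\<^sub>C \<xi> l"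
  shows "k = l"
proof (rule ccontr)
  assume "k \<noteq> l"
  moreover have "cinner (c *\<^sub>C \<xi> k) (\<xi> k) = cinner (d *\<^sub>C \<xi> l) (\<xi> k)"
    using assms(3) by simp
  ultimately show False
    using assms(1,2) by (simp add: cinner_scaleC_left cinner_basis)
qed

text \<open>A linear condition with closed solution set need only be checked on the basis; this
  replaces series expansions.\<close>

lemma closed_csubspace_basis_UNIV:
  assumes "orthonormal_basis \<xi>" "csubspace M" "closed M" "range \<xi> \<subseteq> M"
  shows "M = UNIV"
proof -
  have "cspan (range \<xi>) \<subseteq> M"
    using assms(2,4) by (simp add: complex_vector.span_minimal)
  then have "closure (cspan (range \<xi>)) \<subseteq> M"
    using assms(3) by (simp add: closure_minimal)
  then show ?thesis
    using assms(1) by (auto simp: orthonormal_basis_def)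
qed

text \<open>For an orthonormal basis this set is the closed span of the basis vectors whose index
  fails \<open>P\<close>, described coefficientwise.\<close>

lemma csubspace_coeffs_vanish:
  "csubspace {y. \<forall>l. P l \<longrightarrow> cinner y (\<xi> l) = 0}"
  by (auto intro!: complex_vector.subspaceI simp: cinner_add_left cinner_scaleC_left)

lemma closed_coeffs_vanish:
  assumes "orthonormal_basis \<xi>"
  shows "closed {y. \<forall>l. P l \<longrightarrow> cinner y (\<xi> l) = 0}"
proof -
  have "continuous_on UNIV (\<lambda>y. cinner y (\<xi> l))" for l
    by (rule linear_continuous_on[OF bounded_linear_cinner_unit])
      (simp add: cinner_basis[OF assms])
  then show ?thesis
    by (intro closed_Collect_all closed_Collect_imp closed_Collect_eq) auto
qed


section \<open>Branching systems\<close>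

text \<open>
  The combinatorial shadow of an atomic Cuntz family: \<open>s i k\<close> is the target of the edge with
  label \<open>i\<close> out of vertex \<open>k\<close>, and \<open>a\<close> sends a vertex to the source of its unique incoming edge.
\<close>

definition branching :: "nat \<Rightarrow> (nat \<Rightarrow> nat \<Rightarrow> nat) \<Rightarrow> (nat \<Rightarrow> nat) \<Rightarrow> bool" where
  "branching m s a \<longleftrightarrow>
     (\<forall>i\<in>{1..m}. \<forall>k. a (s i k) = k) \<and>
     (\<forall>i\<in>{1..m}. \<forall>j\<in>{1..m}. \<forall>k l. s i k = s j l \<longrightarrow> i = j) \<and>
     (\<forall>l. \<exists>i\<in>{1..m}. s i (a l) = l)"

lemma branching_pred: "branching m s a \<Longrightarrow> i \<in> {1..m} \<Longrightarrow> a (s i k) = k"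
  unfolding branching_def by blast

lemma branching_label:
  "branching m s a \<Longrightarrow> i \<in> {1..m} \<Longrightarrow> j \<in> {1..m} \<Longrightarrow> s i k = s j l \<Longrightarrow> i = j"
  unfolding branching_def by blast

lemma branching_cover:
  assumes "branching m s a"
  obtains i where "i \<in> {1..m}" "s i (a l) = l"
  using assms unfolding branching_def by blast

lemma branching_foldr_pred:
  assumes "branching m s a" "u \<in> lists {1..m}"
  shows "(a ^^ length u) (foldr s u k) = k"
  using assms(2)
proof (induction u)
  case (Cons i u)
  then show ?case
    by (simp add: funpow_swap1 branching_pred[OF assms(1)])
qed simp

text \<open>The end vertex determines its incoming label and, through \<open>a\<close>, the vertex
  before it, so both words are read off from the common end; equal lengths make the two readings
  stop together.\<close>

lemma branching_foldr_eq:
  assumes "branching m s a" "u \<in> lists {1..m}" "v \<in> lists {1..m}"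
    "length u = length v" "foldr s u k = foldr s v l"
  shows "u = v"
  using assms(4,2,3,5)
proof (induction u v rule: list_induct2)
  case (Cons i u j v)
  then have "i = j"
    using branching_label[OF assms(1), of i j "foldr s u k" "foldr s v l"] by simp
  moreover have "foldr s u k = foldr s v l"
    using Cons.prems branching_pred[OF assms(1), of i "foldr s u k"]
      branching_pred[OF assms(1), of j "foldr s v l"] by simp
  ultimately show ?case
    using Cons by simp
qed simp

section \<open>Commuting maps: cycles and aperiodic points\<close>

lemma funpow_commute:
  assumes "\<And>x. a (b x) = b (a x)"
  shows "(a ^^ p) ((b ^^ q) x) = (b ^^ q) ((a ^^ p) x)"
proof -
  have *: "a ((b ^^ q) x) = (b ^^ q) (a x)" for x
    by (induction q) (simp_all add: assms)
  show ?thesis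
    by (induction p) (simp_all add: *)
qed

lemma funpow_multiple_fixed: "(a ^^ k) h = h \<Longrightarrow> (a ^^ (k * n)) h = h" for a :: "'a \<Rightarrow> 'a"
  by (induction n) (simp_all add: funpow_add)

text \<open>
  If \<open>b\<close> returned to the \<open>a\<close>-cycle of \<open>h\<close>, all powers of \<open>a\<close> and some power of \<open>b\<close> would
  preserve this cycle, so that \<open>h\<close> would be reachable from the point of \<open>L\<close> below \<open>h\<close>.
\<close>

lemma cycle_no_return:
  fixes a b :: "'a \<Rightarrow> 'a"
  assumes comm: "\<And>x. a (b x) = b (a x)"
    and La: "\<forall>x\<in>L. a x \<in> L" and Lb: "\<forall>x\<in>L. b x \<in> L"
    and "h \<notin> L" and inL: "(a ^^ c) ((b ^^ d) h) \<in> L"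
    and "k \<ge> 1" and cycle: "(a ^^ k) h = h"
    and return: "(a ^^ p) ((b ^^ q) h) = (a ^^ r) h"
  shows "q = 0"
proof (rule ccontr)
  assume "q \<noteq> 0"
  \<comment> \<open>\<open>k * Suc r\<close> is a multiple of the period exceeding \<open>r\<close>:
    the steps from \<open>(a ^^ r) h\<close> onwards complete a whole number of turns back to
    \<open>h\<close>, and \<open>e\<close> is positive even for \<open>p = 0\<close>.\<close>
  define e where "e = p + (k * Suc r - r)"
  have r: "(k * Suc r - r) + r = k * Suc r"
    using \<open>k \<ge> 1\<close> by (cases k) auto
  have "r < k * Suc r"
    using \<open>k \<ge> 1\<close> by (cases k) auto
  then have "e \<ge> 1"
    unfolding e_def by linarith
  have "(a ^^ e) ((b ^^ q) h) = (a ^^ (k * Suc r - r)) ((a ^^ r) h)"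
    unfolding e_def by (simp add: add.commute[of p] funpow_add return)
  also have "\<dots> = (a ^^ (k * Suc r)) h"
    by (metis r funpow_add comp_apply)
  also have "\<dots> = h"
    by (rule funpow_multiple_fixed[OF cycle])
  finally have fixed: "(a ^^ e) ((b ^^ q) h) = h" .
  have iter: "(a ^^ (e * N)) ((b ^^ (q * N)) h) = h" for N
  proof (induction N)
    case (Suc N)
    have "(a ^^ (e * Suc N)) ((b ^^ (q * Suc N)) h)
        = (a ^^ (e * N)) ((a ^^ e) ((b ^^ (q * N)) ((b ^^ q) h)))"
      by (simp add: funpow_add add.commute[of e] add.commute[of q])
    also have "\<dots> = (a ^^ (e * N)) ((b ^^ (q * N)) ((a ^^ e) ((b ^^ q) h)))"
      by (simp add: funpow_commute[of a b, OF comm])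
    finally show ?case
      using fixed Suc by simp
  qed simp
  have Lan: "(a ^^ N) x \<in> L" if "x \<in> L" for N x
    using that by (induction N) (auto simp: La)
  have Lbn: "(b ^^ N) x \<in> L" if "x \<in> L" for N x
    using that by (induction N) (auto simp: Lb)
  \<comment> \<open>As \<open>e\<close> and \<open>q\<close> are positive, this \<open>N\<close>
    makes the exponents \<open>e * N\<close> and \<open>q * N\<close> at least \<open>c\<close> and
    \<open>d\<close>, so the path from \<open>h\<close> back to \<open>h\<close> passes through
    \<open>L\<close> and cannot leave it.\<close>
  define N where "N = c + d"
  have cN: "c \<le> e * N"
    using \<open>e \<ge> 1\<close> unfolding N_def by (cases e) auto
  have dN: "d \<le> q * N"
    using \<open>q \<noteq> 0\<close> unfolding N_def by (cases q) auto
  have "(a ^^ (e * N)) ((b ^^ (q * N)) h)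
      = (a ^^ (e * N - c)) ((a ^^ c) ((b ^^ (q * N - d)) ((b ^^ d) h)))"
    using cN dN by (metis funpow_add comp_apply le_add_diff_inverse2)
  also have "\<dots> = (a ^^ (e * N - c)) ((b ^^ (q * N - d)) ((a ^^ c) ((b ^^ d) h)))"
    by (simp add: funpow_commute[of a b, OF comm])
  finally have "h \<in> L"
    using iter inL Lan Lbn by metis
  with \<open>h \<notin> L\<close> show False ..
qed

text \<open>The two conditions exclude the two shapes of a coincidence between paths from
  \<open>z\<close> after common powers are cancelled: both excess powers on one side, or one on each
  side.\<close>

definition aperiodic :: "('a \<Rightarrow> 'a) \<Rightarrow> ('a \<Rightarrow> 'a) \<Rightarrow> 'a \<Rightarrow> bool" where
  "aperiodic a b z \<longleftrightarrow>
     (\<forall>p q. (a ^^ p) ((b ^^ q) z) = z \<longrightarrow> p = 0 \<and> q = 0) \<and>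
     (\<forall>p q. (a ^^ p) z = (b ^^ q) z \<longrightarrow> p = 0 \<and> q = 0)"

text \<open>Reduces the case of a red cycle to that of a blue one with the colours
  exchanged.\<close>

lemma aperiodic_swap:
  assumes "\<And>x. a (b x) = b (a x)" "aperiodic b a z"
  shows "aperiodic a b z"
  using assms(2) unfolding aperiodic_def funpow_commute[of a b, OF assms(1)] by metis

text \<open>A relation at \<open>z\<close> becomes one at \<open>h = a z\<close> after applying
  \<open>a\<close>, and there \<open>cycle_no_return\<close> removes the power of \<open>b\<close>.
  What remains is a pure \<open>a\<close>-period of \<open>z\<close>, which would put
  \<open>z\<close> on the cycle.\<close>

lemma exists_aperiodic_vertex:
  assumes s: "branching m s a" and "m \<ge> 2"
    and comm: "\<And>x. a (b x) = b (a x)"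
    and La: "\<forall>x\<in>L. a x \<in> L" and Lb: "\<forall>x\<in>L. b x \<in> L"
    and "h \<notin> L" and inL: "(a ^^ c) ((b ^^ d) h) \<in> L"
    and "k \<ge> 1" and cycle: "(a ^^ k) h = h"
  shows "\<exists>z. aperiodic a b z"
proof -
  have "s 1 h \<noteq> s 2 h"
    using branching_label[OF s, of 1 2 h h] \<open>m \<ge> 2\<close> by auto
  moreover have "a (s 1 h) = h" "a (s 2 h) = h"
    using branching_pred[OF s] \<open>m \<ge> 2\<close> by auto
  \<comment> \<open>\<open>(a ^^ (k - 1)) h\<close> is the cycle vertex that \<open>a\<close> sends
    to \<open>h\<close>; at most one of the two distinct vertices \<open>s 1 h\<close> and
    \<open>s 2 h\<close> can equal it.\<close>
  ultimately obtain z where z: "a z = h" "z \<noteq> (a ^^ (k - 1)) h"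
    by metis
  note no_return = cycle_no_return[of a b L h c d k,
      OF comm La Lb \<open>h \<notin> L\<close> inL \<open>k \<ge> 1\<close> cycle]
  have aa: "a ((a ^^ p) x) = (a ^^ p) (a x)" for p x
    by (simp add: funpow_swap1)
  have ab: "a ((b ^^ q) x) = (b ^^ q) (a x)" for q x
    using funpow_commute[of a b 1, OF comm] by simp
  \<comment> \<open>A period of \<open>z\<close> makes \<open>z\<close> a power of \<open>a\<close>
    applied to \<open>h\<close>; then \<open>z\<close> inherits the period \<open>k\<close>, and
    unfolding one step identifies it with the excluded cycle vertex.\<close>
  have per: "p = 0" if p: "(a ^^ p) z = z" for p
  proof (rule ccontr)
    assume "p \<noteq> 0"
    then have zh: "z = (a ^^ (p - 1)) h"
      using p z(1) by (cases p) (auto simp: aa)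
    then have "(a ^^ k) z = z"
      using cycle funpow_commute[of a a k "p - 1" h] by simp
    then have "z = (a ^^ (k - 1)) h"
      using \<open>k \<ge> 1\<close> z(1) by (cases k) (auto simp: aa)
    with z(2) show False ..
  qed
  have "aperiodic a b z"
    unfolding aperiodic_def
  proof (intro conjI allI impI)
    fix p q
    assume eq: "(a ^^ p) ((b ^^ q) z) = z"
    have "(a ^^ p) ((b ^^ q) h) = (a ^^ 0) h"
      using arg_cong[OF eq, of a] z(1) by (simp add: aa ab)
    then show "q = 0"
      by (rule no_return)
    with eq per show "p = 0" by simp
  next
    fix p q
    assume eq: "(a ^^ p) z = (b ^^ q) z"
    have "(a ^^ 0) ((b ^^ q) h) = (a ^^ p) h"
      using arg_cong[OF eq, of a] z(1) by (simp add: aa ab)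
    then show "q = 0"
      by (rule no_return)
    with eq per show "p = 0" by simp
  qed
  then show ?thesis ..
qed

text \<open>Cancel the shorter blue word, then strip the red words by powers of \<open>b\<close>.
  Aperiodicity forces equal lengths, and words of equal length are determined by their end
  vertex.\<close>

lemma aperiodic_vertex_words_eq:
  assumes s: "branching m s a" and t: "branching n t b"
    and comm: "\<And>x. a (b x) = b (a x)"
    and z: "aperiodic a b z"
    and u: "u \<in> lists {1..m}" "u' \<in> lists {1..m}"
    and v: "v \<in> lists {1..n}" "v' \<in> lists {1..n}"
    and eq: "foldr s u (foldr t v z) = foldr s u' (foldr t v' z)"
  shows "u = u' \<and> v = v'"
  using u v eq
proof (induction "length u" "length u'" arbitrary: u u' v v' rule: linorder_wlog)
  case le
  \<comment> \<open>By symmetry \<open>u\<close> is the shorter blue word; \<open>w\<close> is the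
    excess of \<open>u'\<close> once a prefix of length \<open>length u\<close> is split
    off.\<close>
  define w where "w = drop (length u) u'"
  define u1 where "u1 = take (length u) u'"
  have u': "u' = u1 @ w" "length u1 = length u" "u1 \<in> lists {1..m}" "w \<in> lists {1..m}"
    using le unfolding u1_def w_def by (auto dest: in_set_takeD in_set_dropD)
  have eq1: "foldr s u (foldr t v z) = foldr s u1 (foldr s w (foldr t v' z))"
    using le u' by simp
  have "u = u1"
    using branching_foldr_eq[OF s _ _ _ eq1] le u' by simp
  have "foldr t v z = foldr s w (foldr t v' z)"
    using arg_cong[OF eq1, of "a ^^ length u"] branching_foldr_pred[OF s] le u' \<open>u = u1\<close> by metis
  then have eq2: "(a ^^ length w) (foldr t v z) = foldr t v' z"
    using branching_foldr_pred[OF s u'(4)] by simp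
  \<comment> \<open>Applying \<open>b\<close> as often as the longer red word demands leaves a
    relation at \<open>z\<close> alone. Its shape depends on whether the longer red word lies on the
    same side as \<open>w\<close>.\<close>
  have len: "length w = 0 \<and> length v = length v'"
  proof (cases "length v \<le> length v'")
    case True
    have "z = (b ^^ length v') ((a ^^ length w) (foldr t v z))"
      using eq2 branching_foldr_pred[OF t] le by simp
    also have "\<dots> = (a ^^ length w) ((b ^^ (length v' - length v)) ((b ^^ length v) (foldr t v z)))"
      using True by (metis funpow_commute[of a b, OF comm] funpow_add comp_apply le_add_diff_inverse2)
    finally have "(a ^^ length w) ((b ^^ (length v' - length v)) z) = z"
      using branching_foldr_pred[OF t] le by simp
    with z True show ?thesis unfolding aperiodic_def by fastforce
  next
    case False
    have "(a ^^ length w) z = (a ^^ length w) ((b ^^ length v) (foldr t v z))"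
      using branching_foldr_pred[OF t] le by simp
    also have "\<dots> = (b ^^ length v) (foldr t v' z)"
      using eq2 by (simp add: funpow_commute[of a b, OF comm])
    also have "\<dots> = (b ^^ (length v - length v')) ((b ^^ length v') (foldr t v' z))"
      using False by (metis funpow_add comp_apply le_add_diff_inverse2 nat_le_linear)
    finally have "(a ^^ length w) z = (b ^^ (length v - length v')) z"
      using branching_foldr_pred[OF t] le by simp
    with z False show ?thesis unfolding aperiodic_def by fastforce
  qed
  then have "v = v'"
    using branching_foldr_eq[OF t _ _ _ , of v v' z z] eq2 le by simp
  with len \<open>u = u1\<close> u' show ?case by simp
next
  case sym
  then show ?case by metis
qed


section \<open>Atomic Cuntz families\<close>

text \<open>The unimodular scalars stay existentially quantified, so that \<open>s\<close> carries
  the action on indices alone.\<close>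

definition atomic_action ::
  "nat \<Rightarrow> (nat \<Rightarrow> 'a::complex_hilbert \<Rightarrow> 'a) \<Rightarrow> (nat \<Rightarrow> 'a) \<Rightarrow> (nat \<Rightarrow> nat \<Rightarrow> nat) \<Rightarrow> bool" where
  "atomic_action m S \<xi> s \<longleftrightarrow>
     (\<forall>i\<in>{1..m}. \<forall>k. \<exists>c. norm c = 1 \<and> S i (\<xi> k) = c *\<^sub>C \<xi> (s i k))"

lemma cuntz_family_clinear:
  assumes "cuntz_family m S" "i \<in> {1..m}"
  shows "bounded_linear (S i)" "S i (c *\<^sub>C x) = c *\<^sub>C S i x" "S i 0 = 0" "S i (x + y) = S i x + S i y"
proof -
  show bl: "bounded_linear (S i)" "S i (c *\<^sub>C x) = c *\<^sub>C S i x"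
    using assms unfolding cuntz_family_def bounded_clinear_def by auto
  show "S i 0 = 0" "S i (x + y) = S i x + S i y"
    using bl(1) by (simp_all add: linear_simps)
qed

lemma cuntz_family_adjoint:
  "cuntz_family m S \<Longrightarrow> i \<in> {1..m} \<Longrightarrow> j \<in> {1..m} \<Longrightarrow>
     cadjoint (S i) (S j x) = (if i = j then x else 0)"
  unfolding cuntz_family_def by blast

lemma basis_neq_0: "orthonormal_basis \<xi> \<Longrightarrow> \<xi> k \<noteq> 0"
  using cinner_basis[of \<xi> k k] by auto

text \<open>Each Cuntz relation gives one property: injectivity of \<open>S i\<close> excludes the
  scalar 0, orthogonal ranges make incoming edges unique, and the sum of the range projections being
  the identity makes them exist.\<close>

lemma cuntz_family_atomic_branching:
  assumes S: "cuntz_family m S" and onb: "orthonormal_basis \<xi>"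
    and atomic: "\<forall>i\<in>{1..m}. \<forall>k. \<exists>c l. (norm c = 1 \<or> c = 0) \<and> S i (\<xi> k) = c *\<^sub>C \<xi> l"
  obtains s a where "atomic_action m S \<xi> s" "branching m s a"
proof -
  note lin = cuntz_family_clinear[OF S] and adj = cuntz_family_adjoint[OF S]
  have "\<exists>c l. norm c = 1 \<and> S i (\<xi> k) = c *\<^sub>C \<xi> l" if i: "i \<in> {1..m}" for i k
  proof -
    obtain c l where c: "norm c = 1 \<or> c = 0" "S i (\<xi> k) = c *\<^sub>C \<xi> l"
      using atomic i by blast
    have "c \<noteq> 0"
    proof
      assume "c = 0"
      then have "S i (\<xi> k) = S i 0"
        using c(2) lin(3)[OF i] by simp
      then have "\<xi> k = 0"
        using adj[OF i i] by metis
      with basis_neq_0[OF onb] show False by blast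
    qed
    with c show ?thesis by blast
  qed
  then obtain c s where cs: "\<And>i k. i \<in> {1..m} \<Longrightarrow> norm (c i k) = 1 \<and> S i (\<xi> k) = c i k *\<^sub>C \<xi> (s i k)"
    by metis
  have label: "i = j \<and> k = l"
    if ij: "i \<in> {1..m}" "j \<in> {1..m}" and eq: "s i k = s j l" for i j k l
  proof -
    \<comment> \<open>The scalars are exchanged crosswise, so that both sides are the same multiple
      of the common target vector.\<close>
    have "S i (c j l *\<^sub>C \<xi> k) = S j (c i k *\<^sub>C \<xi> l)"
      using cs[OF ij(1), of k] cs[OF ij(2), of l] lin(2)[OF ij(1)] lin(2)[OF ij(2)] eq
      by (simp add: scaleC_scaleC mult.commute)
    then have *: "c j l *\<^sub>C \<xi> k = (if i = j then c i k *\<^sub>C \<xi> l else 0)"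
      using adj[OF ij(1) ij(1)] adj[OF ij(1) ij(2)] by metis
    have "c j l \<noteq> 0"
      using cs[OF ij(2), of l] by auto
    then have "i = j"
      using * basis_neq_0[OF onb, of k] by (auto split: if_splits)
    with * show ?thesis
      using scaleC_basis_eq_iff[OF onb \<open>c j l \<noteq> 0\<close>] by auto
  qed
  \<comment> \<open>If no edge ended at \<open>l\<close>, then \<open>\<xi> l\<close> would be
    orthogonal to the range of every \<open>S i\<close>, hence to itself.\<close>
  have cover: "\<exists>i\<in>{1..m}. \<exists>k. s i k = l" for l
  proof (rule ccontr)
    assume no: "\<not> ?thesis"
    have "cinner (S i x) (\<xi> l) = 0" if i: "i \<in> {1..m}" for i x
    proof -
      let ?M = "{x. cinner (S i x) (\<xi> l) = 0}"
      have "csubspace ?M"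
        using lin[OF i] by (auto intro!: complex_vector.subspaceI
            simp: cinner_add_left cinner_scaleC_left)
      moreover have "continuous_on UNIV (\<lambda>x. cinner (S i x) (\<xi> l))"
        by (intro linear_continuous_on bounded_linear_compose[OF bounded_linear_cinner_unit lin(1)[OF i]])
          (simp add: cinner_basis[OF onb])
      then have "closed ?M"
        by (intro closed_Collect_eq) auto
      moreover have "range \<xi> \<subseteq> ?M"
        using no i cs[OF i] by (auto simp: cinner_scaleC_left cinner_basis[OF onb])
      ultimately show ?thesis
        using closed_csubspace_basis_UNIV[OF onb] by blast
    qed
    moreover have "(\<Sum>i\<in>{1..m}. S i (cadjoint (S i) (\<xi> l))) = \<xi> l"
      using S unfolding cuntz_family_def by blast
    ultimately have "cinner (\<xi> l) (\<xi> l) = 0"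
      using cinner_sum_left[of "\<lambda>i. S i (cadjoint (S i) (\<xi> l))" "{1..m}" "\<xi> l"] by simp
    then show False
      by (simp add: cinner_basis[OF onb])
  qed
  define a where "a l = (SOME k. \<exists>i\<in>{1..m}. s i k = l)" for l
  have a: "\<exists>i\<in>{1..m}. s i (a l) = l" for l
    unfolding a_def by (rule someI_ex) (use cover in blast)
  show ?thesis
  proof (rule that)
    show "atomic_action m S \<xi> s"
      unfolding atomic_action_def using cs by blast
    show "branching m s a"
      unfolding branching_def using a label by metis
  qed
qed

text \<open>On basis vectors this is the uniqueness of incoming edges; both sides are linear and
  continuous in \<open>x\<close>, so it extends to the whole space.\<close>

lemma atomic_cuntz_inner:
  assumes S: "cuntz_family m S" and onb: "orthonormal_basis \<xi>"
    and act: "atomic_action m S \<xi> s" and br: "branching m s a"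
    and i: "i \<in> {1..m}" and j: "j \<in> {1..m}"
  shows "cinner (S j x) (S i (\<xi> l)) = (if i = j then cinner x (\<xi> l) else 0)"
proof -
  note lin = cuntz_family_clinear[OF S]
  obtain c where c: "norm c = 1" "S i (\<xi> l) = c *\<^sub>C \<xi> (s i l)"
    using act i unfolding atomic_action_def by blast
  have unit: "d * cnj d = 1" if "norm d = 1" for d
    using complex_norm_square[of d] that by simp
  have 1: "cinner (S i (\<xi> l)) (S i (\<xi> l)) = 1"
    using unit[OF c(1)] unfolding c(2)
    by (simp add: cinner_scaleC_left cinner_scaleC_right cinner_basis[OF onb] mult.commute)
  let ?f = "\<lambda>x. cinner (S j x) (S i (\<xi> l))"
  let ?g = "\<lambda>x. if i = j then cinner x (\<xi> l) else 0"
  let ?M = "{x. ?f x = ?g x}"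
  have "csubspace ?M"
    using lin[OF j] by (auto intro!: complex_vector.subspaceI
        simp: cinner_add_left cinner_scaleC_left)
  moreover have "continuous_on UNIV ?f"
    by (intro linear_continuous_on bounded_linear_compose[OF bounded_linear_cinner_unit[OF 1] lin(1)[OF j]])
  moreover have "continuous_on UNIV ?g"
    using linear_continuous_on[OF bounded_linear_cinner_unit[of "\<xi> l"]]
    by (cases "i = j") (auto simp: cinner_basis[OF onb])
  moreover have "\<xi> k \<in> ?M" for k
  proof -
    obtain d where d: "norm d = 1" "S j (\<xi> k) = d *\<^sub>C \<xi> (s j k)"
      using act j unfolding atomic_action_def by blast
    show ?thesis
    proof (cases "s j k = s i l")
      case True
      have "j = i"
        by (rule branching_label[OF br j i True])
      moreover have "k = l"
        using branching_pred[OF br] i j True by metis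
      ultimately show ?thesis
        using 1 by (simp add: cinner_basis[OF onb])
    next
      case False
      then show ?thesis
        using c d by (auto simp: cinner_scaleC_left cinner_scaleC_right cinner_basis[OF onb])
    qed
  qed
  ultimately have "?M = UNIV"
    by (intro closed_csubspace_basis_UNIV[OF onb] closed_Collect_eq) auto
  then show ?thesis by blast
qed

text \<open>
  Read off from the Cuntz relations on basis vectors; this avoids proving that the adjoint chosen
  by \<open>SOME\<close> in \<^const>\<open>cadjoint\<close> exists.
\<close>

lemma atomic_cuntz_adjoint:
  assumes S: "cuntz_family m S" and onb: "orthonormal_basis \<xi>"
    and act: "atomic_action m S \<xi> s" and br: "branching m s a" and i: "i \<in> {1..m}"
  shows "cinner (cadjoint (S i) y) (\<xi> l) = cinner y (S i (\<xi> l))"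
proof -
  \<comment> \<open>Once \<open>y\<close> is split into its components in the ranges of the
    \<open>S j\<close>, only the component in the range of \<open>S i\<close> contributes.\<close>
  have "cinner y (S i (\<xi> l)) = cinner (\<Sum>j\<in>{1..m}. S j (cadjoint (S j) y)) (S i (\<xi> l))"
    using S unfolding cuntz_family_def by simp
  also have "\<dots> = (\<Sum>j\<in>{1..m}. if i = j then cinner (cadjoint (S j) y) (\<xi> l) else 0)"
    unfolding cinner_sum_left
    by (intro sum.cong refl atomic_cuntz_inner[OF S onb act br i])
  finally show ?thesis
    using i by simp
qed

text \<open>Translates coinvariance into combinatorics: up to a scalar, one of the adjoints walks
  the incoming edge of \<open>l\<close> backwards.\<close>

lemma cadjoint_basis:
  assumes S: "cuntz_family m S" and act: "atomic_action m S \<xi> s" and br: "branching m s a"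
  obtains i c where "i \<in> {1..m}" "norm c = 1" "\<xi> (a l) = c *\<^sub>C cadjoint (S i) (\<xi> l)"
proof -
  obtain i where i: "i \<in> {1..m}" "s i (a l) = l"
    using branching_cover[OF br] by blast
  obtain c where c: "norm c = 1" "S i (\<xi> (a l)) = c *\<^sub>C \<xi> l"
    using act i unfolding atomic_action_def by metis
  have "c \<noteq> 0" using c by auto
  then have "S i (inverse c *\<^sub>C \<xi> (a l)) = \<xi> l"
    using cuntz_family_clinear(2)[OF S i(1)] c by (simp add: scaleC_scaleC scaleC_one)
  then have "cadjoint (S i) (\<xi> l) = inverse c *\<^sub>C \<xi> (a l)"
    using cuntz_family_adjoint[OF S i(1) i(1)] by metis
  then have "\<xi> (a l) = c *\<^sub>C cadjoint (S i) (\<xi> l)"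
    using \<open>c \<noteq> 0\<close> by (simp add: scaleC_scaleC scaleC_one)
  with i c that show ?thesis by blast
qed

section \<open>Words of operators acting on basis vectors\<close>

lemma word_op_Nil [simp]: "word_op S [] = id"
  by (simp add: word_op_def)

lemma word_op_Cons [simp]: "word_op S (i # u) = S i \<circ> word_op S u"
  by (simp add: word_op_def)

lemma word_op_scaleC:
  assumes "cuntz_family m S" "u \<in> lists {1..m}"
  shows "word_op S u (c *\<^sub>C x) = c *\<^sub>C word_op S u x"
  using assms(2) by (induction u) (auto simp: cuntz_family_clinear[OF assms(1)])

lemma word_op_basis:
  assumes S: "cuntz_family m S" and act: "atomic_action m S \<xi> s" and u: "u \<in> lists {1..m}"
  obtains c where "norm c = 1" "word_op S u (\<xi> k) = c *\<^sub>C \<xi> (foldr s u k)"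
proof -
  have "\<exists>c. norm c = 1 \<and> word_op S u (\<xi> k) = c *\<^sub>C \<xi> (foldr s u k)"
    using u
  proof (induction u)
    case Nil
    show ?case by (intro exI[of _ 1]) (simp add: scaleC_one)
  next
    case (Cons i u)
    then obtain c where c: "norm c = 1" "word_op S u (\<xi> k) = c *\<^sub>C \<xi> (foldr s u k)"
      by auto
    have "i \<in> {1..m}"
      using Cons.hyps by simp
    then obtain d where d: "norm d = 1" "S i (\<xi> (foldr s u k)) = d *\<^sub>C \<xi> (s i (foldr s u k))"
      using act unfolding atomic_action_def by blast
    have "S i (word_op S u (\<xi> k)) = (c * d) *\<^sub>C \<xi> (s i (foldr s u k))"
      using c d cuntz_family_clinear(2)[OF S \<open>i \<in> {1..m}\<close>] by (simp add: scaleC_scaleC)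
    then show ?case
      using c d by (intro exI[of _ "c * d"]) (simp add: norm_mult)
  qed
  with that show ?thesis by blast
qed

lemma word_op_return:
  assumes S: "cuntz_family m S" and onb: "orthonormal_basis \<xi>"
    and act: "atomic_action m S \<xi> s" and br: "branching m s a"
    and u: "u \<in> lists {1..m}" and "cinner (word_op S u (\<xi> h)) (\<xi> h) \<noteq> 0"
  shows "(a ^^ length u) h = h"
proof -
  obtain c where "norm c = 1" "word_op S u (\<xi> h) = c *\<^sub>C \<xi> (foldr s u h)"
    using word_op_basis[OF S act u] by blast
  then have "foldr s u h = h"
    using assms(6) by (auto simp: cinner_scaleC_left cinner_basis[OF onb] split: if_splits)
  then show ?thesis
    using branching_foldr_pred[OF br u, of h] by simp
qed

text \<open>The coefficient of \<open>S i y\<close> at \<open>l\<close> is zero or, up to a scalar,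
  that of \<open>y\<close> at \<open>a l\<close>; for the adjoint it is that of \<open>y\<close> at
  \<open>s i l\<close>. A set \<open>L\<close> saturated under \<open>a\<close> contains neither
  index when it misses \<open>l\<close>.\<close>

lemma atomic_cuntz_reducing:
  assumes S: "cuntz_family m S" and onb: "orthonormal_basis \<xi>"
    and act: "atomic_action m S \<xi> s" and br: "branching m s a"
    and L: "\<And>l. a l \<in> L \<longleftrightarrow> l \<in> L" and i: "i \<in> {1..m}"
    and y: "\<And>l. l \<notin> L \<Longrightarrow> cinner y (\<xi> l) = 0" and l: "l \<notin> L"
  shows "cinner (S i y) (\<xi> l) = 0" "cinner (cadjoint (S i) y) (\<xi> l) = 0"
proof -
  obtain j where j: "j \<in> {1..m}" "s j (a l) = l"
    using branching_cover[OF br] by blast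
  obtain c where c: "norm c = 1" "S j (\<xi> (a l)) = c *\<^sub>C \<xi> l"
    using act j unfolding atomic_action_def by metis
  have "cinner (S i y) (S j (\<xi> (a l))) = 0"
    using atomic_cuntz_inner[OF S onb act br j(1) i] y[of "a l"] L l by simp
  then show "cinner (S i y) (\<xi> l) = 0"
    using c by (auto simp: cinner_scaleC_right)
  obtain d where d: "S i (\<xi> l) = d *\<^sub>C \<xi> (s i l)"
    using act i unfolding atomic_action_def by metis
  have "s i l \<notin> L"
    using L[of "s i l"] l branching_pred[OF br i] by simp
  then show "cinner (cadjoint (S i) y) (\<xi> l) = 0"
    using atomic_cuntz_adjoint[OF S onb act br i] y d by (simp add: cinner_scaleC_right)
qed


section \<open>Words of the 2-graph\<close>

definition gen_op :: "(nat \<Rightarrow> 'a \<Rightarrow> 'a) \<Rightarrow> (nat \<Rightarrow> 'a \<Rightarrow> 'a) \<Rightarrow> generator \<Rightarrow> 'a \<Rightarrow> 'a" where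
  "gen_op S T g = (case g of Gen_e i \<Rightarrow> S i | Gen_f j \<Rightarrow> T j)"

text \<open>Evaluates representatives rather than classes, so that the choice hidden in
  \<open>ST_op\<close> can be resolved by invariance under the congruence.\<close>

definition eval_word ::
  "(nat \<Rightarrow> 'a \<Rightarrow> 'a) \<Rightarrow> (nat \<Rightarrow> 'a \<Rightarrow> 'a) \<Rightarrow> generator list \<Rightarrow> 'a \<Rightarrow> 'a" where
  "eval_word S T w = foldr (gen_op S T) w"

lemma eval_word_append: "eval_word S T (x @ y) = eval_word S T x \<circ> eval_word S T y"
  by (simp add: eval_word_def fun_eq_iff)

lemma eval_word_e: "eval_word S T (map Gen_e u) = word_op S u"
  by (induction u) (simp_all add: eval_word_def gen_op_def fun_eq_iff)

lemma eval_word_f: "eval_word S T (map Gen_f v) = word_op T v"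
  by (induction v) (simp_all add: eval_word_def gen_op_def fun_eq_iff)

lemma eval_word_cong:
  assumes rep: "cuntz_type_rep m n \<theta> S T" and "(w, w') \<in> theta_cong m n \<theta>"
  shows "eval_word S T w = eval_word S T w'"
proof -
  have step: "eval_word S T x = eval_word S T y" if xy: "(x, y) \<in> theta_step m n \<theta>" for x y
  proof -
    obtain p q i j i' j' where *: "x = p @ [Gen_e i, Gen_f j] @ q" "y = p @ [Gen_f j', Gen_e i'] @ q"
      "i \<in> {1..m}" "j \<in> {1..n}" "\<theta> (i, j) = (i', j')"
      using xy unfolding theta_step_def by blast
    then have "S i \<circ> T j = T j' \<circ> S i'"
      using rep unfolding cuntz_type_rep_def by blast
    then have "eval_word S T [Gen_e i, Gen_f j] = eval_word S T [Gen_f j', Gen_e i']"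
      by (simp add: eval_word_def gen_op_def fun_eq_iff)
    with * show ?thesis
      by (simp only: eval_word_append)
  qed
  show ?thesis
    using assms(2) unfolding theta_cong_def
    by (induction rule: rtrancl_induct) (auto dest: step)
qed

section \<open>Rewriting modulo the congruence and normal forms\<close>

lemma theta_cong_refl [simp]: "(w, w) \<in> theta_cong m n \<theta>"
  by (simp add: theta_cong_def)

lemma theta_cong_trans:
  "(x, y) \<in> theta_cong m n \<theta> \<Longrightarrow> (y, z) \<in> theta_cong m n \<theta> \<Longrightarrow> (x, z) \<in> theta_cong m n \<theta>"
  unfolding theta_cong_def by (rule rtrancl_trans)

lemma theta_cong_sym: "(x, y) \<in> theta_cong m n \<theta> \<Longrightarrow> (y, x) \<in> theta_cong m n \<theta>"
  unfolding theta_cong_def by (metis sym_Un_converse sym_rtrancl symD)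

lemma theta_cong_context:
  assumes "(w, w') \<in> theta_cong m n \<theta>" "x \<in> gen_words m n" "y \<in> gen_words m n"
  shows "(x @ w @ y, x @ w' @ y) \<in> theta_cong m n \<theta>"
proof -
  have context_step: "(x @ p @ y, x @ q @ y) \<in> theta_step m n \<theta>" if pq: "(p, q) \<in> theta_step m n \<theta>" for p q
  proof -
    obtain p' q' i j i' j' where *: "p = p' @ [Gen_e i, Gen_f j] @ q'" "q = p' @ [Gen_f j', Gen_e i'] @ q'"
      "p' \<in> gen_words m n" "q' \<in> gen_words m n" "i \<in> {1..m}" "j \<in> {1..n}" "\<theta> (i, j) = (i', j')"
      using pq unfolding theta_step_def by blast
    have "x @ p' \<in> gen_words m n" "q' @ y \<in> gen_words m n"
      using assms *(3,4) unfolding gen_words_def by auto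
    moreover have "x @ p @ y = (x @ p') @ [Gen_e i, Gen_f j] @ (q' @ y)"
      "x @ q @ y = (x @ p') @ [Gen_f j', Gen_e i'] @ (q' @ y)"
      using * by auto
    ultimately show ?thesis
      unfolding theta_step_def using *(5-7) by blast
  qed
  show ?thesis
    using assms(1) unfolding theta_cong_def
  proof (induction rule: rtrancl_induct)
    case (step p q)
    from step(2) have "(x @ p @ y, x @ q @ y) \<in> theta_step m n \<theta> \<union> (theta_step m n \<theta>)\<inverse>"
      using context_step by blast
    with step(3) show ?case by (rule rtrancl_into_rtrancl)
  qed simp
qed

lemma gen_words_normal:
  "u \<in> lists {1..m} \<Longrightarrow> v \<in> lists {1..n} \<Longrightarrow> map Gen_e u @ map Gen_f v \<in> gen_words m n"
  unfolding gen_words_def by auto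

text \<open>Surjectivity of \<open>\<theta>\<close> on the label pairs allows each relation to be
  read from right to left: \<open>f\<close> followed by \<open>e\<close> can always be rewritten as
  \<open>e\<close> followed by \<open>f\<close>.\<close>

lemma f_past_e_word:
  assumes \<theta>: "\<theta> permutes {1..m} \<times> {1..n}" and "j \<in> {1..n}" "u \<in> lists {1..m}"
  shows "\<exists>u'\<in>lists {1..m}. \<exists>j'\<in>{1..n}.
    (Gen_f j # map Gen_e u, map Gen_e u' @ [Gen_f j']) \<in> theta_cong m n \<theta>"
  using assms(3,2)
proof (induction u arbitrary: j)
  case Nil
  then show ?case by (intro bexI[of _ "[]"] bexI[of _ j]) auto
next
  case (Cons i u)
  have "(i, j) \<in> \<theta> ` ({1..m} \<times> {1..n})"
    using Cons permutes_image[OF \<theta>] by auto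
  then obtain i0 j0 where ij: "i0 \<in> {1..m}" "j0 \<in> {1..n}" "\<theta> (i0, j0) = (i, j)"
    by auto
  then obtain u' j' where u': "u' \<in> lists {1..m}" "j' \<in> {1..n}"
    "(Gen_f j0 # map Gen_e u, map Gen_e u' @ [Gen_f j']) \<in> theta_cong m n \<theta>"
    using Cons.IH by blast
  have "([Gen_e i0, Gen_f j0], [Gen_f j, Gen_e i]) \<in> theta_step m n \<theta>"
    unfolding theta_step_def using ij by (fastforce simp: gen_words_def)
  then have "([Gen_f j, Gen_e i], [Gen_e i0, Gen_f j0]) \<in> theta_cong m n \<theta>"
    unfolding theta_cong_def by blast
  from theta_cong_context[OF this, of "[]" "map Gen_e u"] gen_words_normal[OF Cons.hyps(2), of "[]" n]
  have "(Gen_f j # map Gen_e (i # u), Gen_e i0 # Gen_f j0 # map Gen_e u) \<in> theta_cong m n \<theta>"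
    by (simp add: gen_words_def)
  moreover have "(Gen_e i0 # Gen_f j0 # map Gen_e u, Gen_e i0 # map Gen_e u' @ [Gen_f j']) \<in> theta_cong m n \<theta>"
    using theta_cong_context[OF u'(3), of "[Gen_e i0]" "[]"] ij by (simp add: gen_words_def)
  ultimately have "(Gen_f j # map Gen_e (i # u), map Gen_e (i0 # u') @ [Gen_f j']) \<in> theta_cong m n \<theta>"
    by (auto intro: theta_cong_trans)
  then show ?case
    using u' ij by (intro bexI[of _ "i0 # u'"] bexI[of _ j']) auto
qed

text \<open>A new leading \<open>Gen_e\<close> joins the \<open>e\<close>-block directly; a new
  leading \<open>Gen_f\<close> is first carried through that block.\<close>

lemma normal_form:
  assumes \<theta>: "\<theta> permutes {1..m} \<times> {1..n}" and "w \<in> gen_words m n"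
  shows "\<exists>u\<in>lists {1..m}. \<exists>v\<in>lists {1..n}. (w, map Gen_e u @ map Gen_f v) \<in> theta_cong m n \<theta>"
  using assms(2) unfolding gen_words_def
proof (induction w)
  case Nil
  show ?case by (intro bexI[of _ "[]"]) auto
next
  case (Cons g w)
  then obtain u v where uv: "u \<in> lists {1..m}" "v \<in> lists {1..n}"
    "(w, map Gen_e u @ map Gen_f v) \<in> theta_cong m n \<theta>"
    by auto
  have g: "(g # w, g # map Gen_e u @ map Gen_f v) \<in> theta_cong m n \<theta>"
    using theta_cong_context[OF uv(3), of "[g]" "[]"] Cons by (auto simp: gen_words_def)
  from Cons consider (e) i where "g = Gen_e i" "i \<in> {1..m}" | (f) j where "g = Gen_f j" "j \<in> {1..n}"
    by auto
  then show ?case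
  proof cases
    case e
    with g uv show ?thesis
      by (intro bexI[of _ "i # u"] bexI[of _ v]) auto
  next
    case f
    obtain u' j' where u': "u' \<in> lists {1..m}" "j' \<in> {1..n}"
      "(Gen_f j # map Gen_e u, map Gen_e u' @ [Gen_f j']) \<in> theta_cong m n \<theta>"
      using f_past_e_word[OF \<theta> f(2) uv(1)] by blast
    have "(g # map Gen_e u @ map Gen_f v, map Gen_e u' @ map Gen_f (j' # v)) \<in> theta_cong m n \<theta>"
      using theta_cong_context[OF u'(3), of "[]" "map Gen_f v"] f gen_words_normal[OF _ uv(2), of "[]" m]
      by (simp add: gen_words_def)
    with g have "(g # w, map Gen_e u' @ map Gen_f (j' # v)) \<in> theta_cong m n \<theta>"
      by (rule theta_cong_trans)
    then show ?thesis
      using u' uv by (intro bexI[of _ u'] bexI[of _ "j' # v"]) auto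
  qed
qed

text \<open>Every normal form in the class evaluates to the same operator as \<open>w\<close>, and
  one exists, so the definite description is met by exactly one operator.\<close>

lemma ST_op_class:
  assumes rep: "cuntz_type_rep m n \<theta> S T" and \<theta>: "\<theta> permutes {1..m} \<times> {1..n}"
    and w: "w \<in> gen_words m n"
  shows "ST_op m n S T (theta_cong m n \<theta> `` {w}) = eval_word S T w"
  unfolding ST_op_def
proof (rule the_equality)
  obtain u v where uv: "u \<in> lists {1..m}" "v \<in> lists {1..n}"
    "(w, map Gen_e u @ map Gen_f v) \<in> theta_cong m n \<theta>"
    using normal_form[OF \<theta> w] by blast
  moreover have "eval_word S T w = word_op S u \<circ> word_op T v"
    using eval_word_cong[OF rep uv(3)] by (simp add: eval_word_append eval_word_e eval_word_f)
  ultimately show "\<exists>u\<in>lists {1..m}. \<exists>v\<in>lists {1..n}.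
      map Gen_e u @ map Gen_f v \<in> theta_cong m n \<theta> `` {w} \<and> eval_word S T w = word_op S u \<circ> word_op T v"
    by blast
next
  fix A
  assume "\<exists>u\<in>lists {1..m}. \<exists>v\<in>lists {1..n}.
      map Gen_e u @ map Gen_f v \<in> theta_cong m n \<theta> `` {w} \<and> A = word_op S u \<circ> word_op T v"
  then obtain u v where "(w, map Gen_e u @ map Gen_f v) \<in> theta_cong m n \<theta>"
    "A = word_op S u \<circ> word_op T v"
    by blast
  then show "A = eval_word S T w"
    using eval_word_cong[OF rep] by (simp add: eval_word_append eval_word_e eval_word_f)
qed

lemma theta_semigroup_normal_form:
  assumes rep: "cuntz_type_rep m n \<theta> S T" and \<theta>: "\<theta> permutes {1..m} \<times> {1..n}"
    and "w \<in> theta_semigroup m n \<theta>"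
  obtains u v where "u \<in> lists {1..m}" "v \<in> lists {1..n}"
    "w = theta_cong m n \<theta> `` {map Gen_e u @ map Gen_f v}"
    "ST_op m n S T w = word_op S u \<circ> word_op T v"
proof -
  obtain x where x: "x \<in> gen_words m n" "w = theta_cong m n \<theta> `` {x}"
    using assms(3) unfolding theta_semigroup_def by (rule quotientE)
  obtain u v where uv: "u \<in> lists {1..m}" "v \<in> lists {1..n}"
    "(x, map Gen_e u @ map Gen_f v) \<in> theta_cong m n \<theta>"
    using normal_form[OF \<theta> x(1)] by blast
  then have w: "w = theta_cong m n \<theta> `` {map Gen_e u @ map Gen_f v}"
    using x(2) by (auto intro: theta_cong_trans theta_cong_sym)
  with ST_op_class[OF rep \<theta> gen_words_normal[OF uv(1,2)]]
  have "ST_op m n S T w = word_op S u \<circ> word_op T v"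
    by (simp add: eval_word_append eval_word_e eval_word_f)
  with that uv(1,2) w show ?thesis by blast
qed

lemma atomic_rep_generators:
  assumes rep: "cuntz_type_rep m n \<theta> S T" and \<theta>: "\<theta> permutes {1..m} \<times> {1..n}"
    and atomic: "atomic_rep m n \<theta> S T \<xi>"
  shows "\<forall>i\<in>{1..m}. \<forall>k. \<exists>c l. (norm c = 1 \<or> c = 0) \<and> S i (\<xi> k) = c *\<^sub>C \<xi> l"
    and "\<forall>j\<in>{1..n}. \<forall>k. \<exists>c l. (norm c = 1 \<or> c = 0) \<and> T j (\<xi> k) = c *\<^sub>C \<xi> l"
proof -
  have *: "\<exists>c l. (norm c = 1 \<or> c = 0) \<and> eval_word S T w (\<xi> k) = c *\<^sub>C \<xi> l"
    if "w \<in> gen_words m n" for w k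
  proof -
    have "theta_cong m n \<theta> `` {w} \<in> theta_semigroup m n \<theta>"
      unfolding theta_semigroup_def using that by (rule quotientI)
    then show ?thesis
      using atomic ST_op_class[OF rep \<theta> that] unfolding atomic_rep_def by metis
  qed
  show "\<forall>i\<in>{1..m}. \<forall>k. \<exists>c l. (norm c = 1 \<or> c = 0) \<and> S i (\<xi> k) = c *\<^sub>C \<xi> l"
    using *[of "[Gen_e i]" for i] by (auto simp: gen_words_def eval_word_def gen_op_def)
  show "\<forall>j\<in>{1..n}. \<forall>k. \<exists>c l. (norm c = 1 \<or> c = 0) \<and> T j (\<xi> k) = c *\<^sub>C \<xi> l"
    using *[of "[Gen_f j]" for j] by (auto simp: gen_words_def eval_word_def gen_op_def)
qed


section \<open>The wandering vector\<close>

text \<open>The path into \<open>l\<close> that is red and then blue starts at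
  \<open>y = b (a l)\<close>. The commutation relation completes it to a square whose other path,
  blue and then red, also leads from \<open>y\<close> to \<open>l\<close>; walking that path
  backwards gives \<open>a (b l) = y\<close>.\<close>

lemma pred_commute:
  assumes rep: "cuntz_type_rep m n \<theta> S T" and onb: "orthonormal_basis \<xi>"
    and s: "atomic_action m S \<xi> s" "branching m s a"
    and t: "atomic_action n T \<xi> t" "branching n t b"
    and \<theta>: "\<theta> permutes {1..m} \<times> {1..n}"
  shows "a (b l) = b (a l)"
proof -
  have S: "cuntz_family m S" and T: "cuntz_family n T"
    using rep unfolding cuntz_type_rep_def by auto
  obtain i where i: "i \<in> {1..m}" "s i (a l) = l"
    using branching_cover[OF s(2)] by blast
  obtain j where j: "j \<in> {1..n}" "t j (b (a l)) = a l"
    using branching_cover[OF t(2)] by blast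
  define y where "y = b (a l)"
  obtain i' j' where ij': "\<theta> (i, j) = (i', j')"
    by (cases "\<theta> (i, j)")
  then have mem: "i' \<in> {1..m}" "j' \<in> {1..n}"
    using permutes_in_image[OF \<theta>, of "(i, j)"] i j by auto
  have comm: "S i (T j (\<xi> y)) = T j' (S i' (\<xi> y))"
    using rep i(1) j(1) ij' unfolding cuntz_type_rep_def fun_eq_iff by (metis comp_apply)
  obtain c1 where c1: "norm c1 = 1" "T j (\<xi> y) = c1 *\<^sub>C \<xi> (t j y)"
    using t(1) j(1) unfolding atomic_action_def by blast
  obtain c2 where c2: "norm c2 = 1" "S i (\<xi> (t j y)) = c2 *\<^sub>C \<xi> (s i (t j y))"
    using s(1) i(1) unfolding atomic_action_def by blast
  obtain c3 where c3: "norm c3 = 1" "S i' (\<xi> y) = c3 *\<^sub>C \<xi> (s i' y)"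
    using s(1) mem unfolding atomic_action_def by blast
  obtain c4 where c4: "norm c4 = 1" "T j' (\<xi> (s i' y)) = c4 *\<^sub>C \<xi> (t j' (s i' y))"
    using t(1) mem unfolding atomic_action_def by blast
  have "(c1 * c2) *\<^sub>C \<xi> (s i (t j y)) = (c3 * c4) *\<^sub>C \<xi> (t j' (s i' y))"
    using comm c1 c2 c3 c4 cuntz_family_clinear(2)[OF S i(1)] cuntz_family_clinear(2)[OF T mem(2)]
    by (simp add: scaleC_scaleC)
  moreover have "c1 * c2 \<noteq> 0"
    using c1 c2 by auto
  ultimately have "s i (t j y) = t j' (s i' y)"
    using scaleC_basis_eq_iff[OF onb] by blast
  then have "l = t j' (s i' y)"
    using i j y_def by simp
  then have "a (b l) = y"
    using branching_pred[OF t(2) mem(2)] branching_pred[OF s(2) mem(1)] by simp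
  then show ?thesis
    by (simp add: y_def)
qed

text \<open>Different classes have different normal forms, which by \<open>free\<close> carry
  \<open>z\<close> to different indices and hence to orthogonal vectors.\<close>

lemma wandering_basis_vector:
  assumes rep: "cuntz_type_rep m n \<theta> S T" and onb: "orthonormal_basis \<xi>"
    and s: "atomic_action m S \<xi> s" and t: "atomic_action n T \<xi> t"
    and \<theta>: "\<theta> permutes {1..m} \<times> {1..n}"
    and free: "\<And>u u' v v'. \<lbrakk>u \<in> lists {1..m}; u' \<in> lists {1..m}; v \<in> lists {1..n}; v' \<in> lists {1..n};
      foldr s u (foldr t v z) = foldr s u' (foldr t v' z)\<rbrakk> \<Longrightarrow> u = u' \<and> v = v'"
  shows "wandering m n \<theta> S T (\<xi> z)"
  unfolding wandering_def
proof (intro conjI ballI)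
  show "norm (\<xi> z) = 1"
    by (simp add: norm_eq_sqrt_cinner cinner_basis[OF onb])
  have S: "cuntz_family m S" and T: "cuntz_family n T"
    using rep unfolding cuntz_type_rep_def by auto
  have act: "\<exists>c. norm c = 1 \<and> (word_op S u \<circ> word_op T v) (\<xi> z) = c *\<^sub>C \<xi> (foldr s u (foldr t v z))"
    if uv: "u \<in> lists {1..m}" "v \<in> lists {1..n}" for u v
  proof -
    obtain c where c: "norm c = 1" "word_op T v (\<xi> z) = c *\<^sub>C \<xi> (foldr t v z)"
      using word_op_basis[OF T t uv(2)] by blast
    obtain d where d: "norm d = 1"
      "word_op S u (\<xi> (foldr t v z)) = d *\<^sub>C \<xi> (foldr s u (foldr t v z))"
      using word_op_basis[OF S s uv(1)] by blast
    show ?thesis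
      using c d by (intro exI[of _ "c * d"])
        (simp add: norm_mult word_op_scaleC[OF S uv(1)] scaleC_scaleC)
  qed
  fix w w'
  assume "w \<in> theta_semigroup m n \<theta>" "w' \<in> theta_semigroup m n \<theta>"
  then obtain u v u' v' where
    uv: "u \<in> lists {1..m}" "v \<in> lists {1..n}"
      "w = theta_cong m n \<theta> `` {map Gen_e u @ map Gen_f v}"
      "ST_op m n S T w = word_op S u \<circ> word_op T v" and
    uv': "u' \<in> lists {1..m}" "v' \<in> lists {1..n}"
      "w' = theta_cong m n \<theta> `` {map Gen_e u' @ map Gen_f v'}"
      "ST_op m n S T w' = word_op S u' \<circ> word_op T v'"
    by (metis theta_semigroup_normal_form[OF rep \<theta>])
  obtain c where c: "norm c = 1" "ST_op m n S T w (\<xi> z) = c *\<^sub>C \<xi> (foldr s u (foldr t v z))"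
    using act[OF uv(1,2)] uv(4) by auto
  obtain c' where c': "norm c' = 1"
    "ST_op m n S T w' (\<xi> z) = c' *\<^sub>C \<xi> (foldr s u' (foldr t v' z))"
    using act[OF uv'(1,2)] uv'(4) by auto
  show "cinner (ST_op m n S T w (\<xi> z)) (ST_op m n S T w' (\<xi> z)) = (if w = w' then 1 else 0)"
  proof (cases "w = w'")
    case True
    have "c * cnj c = 1"
      using complex_norm_square[of c] c by simp
    then show ?thesis
      using True c by (simp add: cinner_scaleC_left cinner_scaleC_right cinner_basis[OF onb] mult.commute)
  next
    case False
    then have "foldr s u (foldr t v z) \<noteq> foldr s u' (foldr t v' z)"
      using free[OF uv(1) uv'(1) uv(2) uv'(2)] uv(3) uv'(3) by blast
    then show ?thesis
      using False c c' by (simp add: cinner_scaleC_left cinner_scaleC_right cinner_basis[OF onb])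
  qed
qed

theorem proposition6p6:
  fixes m n :: nat
    and \<theta> :: "nat \<times> nat \<Rightarrow> nat \<times> nat"
    and S T :: "nat \<Rightarrow> 'a::complex_hilbert \<Rightarrow> 'a"
    and \<xi> :: "nat \<Rightarrow> 'a"
    and V :: "'a set"
    and \<eta> :: 'a
  assumes "m \<ge> 2" and "n \<ge> 2"
    and "\<theta> permutes {1..m} \<times> {1..n}"
    and "cuntz_type_rep m n \<theta> S T"
    and "irreducible_rep m n S T"
    and "atomic_rep m n \<theta> S T \<xi>"
    and "type_1 m n S T \<xi>"
    and "minimal_coinvariant_cyclic m n \<theta> S T \<xi> V"
    and "\<eta> \<in> range \<xi>" and "\<eta> \<in> orth_complement V"
    and "(\<exists>u\<in>lists {1..m}. u \<noteq> [] \<and> cinner (word_op S u \<eta>) \<eta> \<noteq> 0) \<or>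
         (\<exists>v\<in>lists {1..n}. v \<noteq> [] \<and> cinner (word_op T v \<eta>) \<eta> \<noteq> 0)"
  shows "\<exists>\<zeta>\<in>range \<xi>. wandering m n \<theta> S T \<zeta>"
proof -
  note \<theta> = assms(3) and rep = assms(4)
  have S: "cuntz_family m S" and T: "cuntz_family n T"
    using rep unfolding cuntz_type_rep_def by auto
  have onb: "orthonormal_basis \<xi>"
    using assms(6) unfolding atomic_rep_def by blast
  obtain s a where s: "atomic_action m S \<xi> s" "branching m s a"
    using cuntz_family_atomic_branching[OF S onb atomic_rep_generators(1)[OF rep \<theta> assms(6)]] .
  obtain t b where t: "atomic_action n T \<xi> t" "branching n t b"
    using cuntz_family_atomic_branching[OF T onb atomic_rep_generators(2)[OF rep \<theta> assms(6)]] .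
  have comm: "a (b l) = b (a l)" for l
    by (rule pred_commute[OF rep onb s t \<theta>])
  obtain x where x: "V = (\<lambda>M. csubspace M \<and> coinvariant m n S T M) hull {\<xi> x}"
    using assms(8) unfolding minimal_coinvariant_cyclic_def by blast
  define L where "L = {l. \<xi> l \<in> V}"
  have "x \<in> L"
    unfolding L_def x by (simp add: hull_inc)
  have La: "\<forall>l\<in>L. a l \<in> L"
  proof
    fix l assume "l \<in> L"
    obtain i c where ic: "i \<in> {1..m}" "\<xi> (a l) = c *\<^sub>C cadjoint (S i) (\<xi> l)"
      using cadjoint_basis[OF S s] by metis
    \<comment> \<open>The hull is an intersection, so closure under \<open>a\<close> is checked in
      each coinvariant subspace containing \<open>\<xi> x\<close>.\<close>
    have "\<xi> (a l) \<in> M" if "csubspace M \<and> coinvariant m n S T M" "\<xi> l \<in> M" for M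
    proof -
      have "cadjoint (S i) (\<xi> l) \<in> M"
        using that ic(1) unfolding coinvariant_def by blast
      then show ?thesis
        unfolding ic(2) using that(1) by (blast intro: complex_vector.subspace_scale)
    qed
    with \<open>l \<in> L\<close> show "a l \<in> L"
      unfolding L_def x by (auto simp: hull_def)
  qed
  have Lb: "\<forall>l\<in>L. b l \<in> L"
  proof
    fix l assume "l \<in> L"
    obtain j c where jc: "j \<in> {1..n}" "\<xi> (b l) = c *\<^sub>C cadjoint (T j) (\<xi> l)"
      using cadjoint_basis[OF T t] by metis
    have "\<xi> (b l) \<in> M" if "csubspace M \<and> coinvariant m n S T M" "\<xi> l \<in> M" for M
    proof -
      have "cadjoint (T j) (\<xi> l) \<in> M"
        using that jc(1) unfolding coinvariant_def by blast
      then show ?thesis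
        unfolding jc(2) using that(1) by (blast intro: complex_vector.subspace_scale)
    qed
    with \<open>l \<in> L\<close> show "b l \<in> L"
      unfolding L_def x by (auto simp: hull_def)
  qed
  \<comment> \<open>Saturating \<open>L\<close> gives a set stable under \<open>a\<close> and
    \<open>b\<close> in both directions, as a reducing subspace requires.\<close>
  define L' where "L' = {l. \<exists>c d. (a ^^ c) ((b ^^ d) l) \<in> L}"
  have ab: "a ((b ^^ q) l) = (b ^^ q) (a l)" for q l
    using funpow_commute[of a b 1, OF comm] by simp
  have L'a: "a l \<in> L' \<longleftrightarrow> l \<in> L'" for l
  proof
    assume "a l \<in> L'"
    then obtain c d where "(a ^^ c) ((b ^^ d) (a l)) \<in> L"
      unfolding L'_def by blast
    then have "(a ^^ Suc c) ((b ^^ d) l) \<in> L"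
      unfolding funpow_Suc_right by (simp add: ab)
    then show "l \<in> L'"
      unfolding L'_def by blast
  next
    assume "l \<in> L'"
    then obtain c d where "(a ^^ c) ((b ^^ d) l) \<in> L"
      unfolding L'_def by blast
    then have "a ((a ^^ c) ((b ^^ d) l)) \<in> L"
      using La by blast
    then have "(a ^^ c) ((b ^^ d) (a l)) \<in> L"
      by (simp add: funpow_swap1 ab)
    then show "a l \<in> L'"
      unfolding L'_def by blast
  qed
  have L'b: "b l \<in> L' \<longleftrightarrow> l \<in> L'" for l
  proof
    assume "b l \<in> L'"
    then obtain c d where "(a ^^ c) ((b ^^ d) (b l)) \<in> L"
      unfolding L'_def by blast
    then have "(a ^^ c) ((b ^^ Suc d) l) \<in> L"
      unfolding funpow_Suc_right by simp
    then show "l \<in> L'"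
      unfolding L'_def by blast
  next
    assume "l \<in> L'"
    then obtain c d where "(a ^^ c) ((b ^^ d) l) \<in> L"
      unfolding L'_def by blast
    then have "b ((a ^^ c) ((b ^^ d) l)) \<in> L"
      using Lb by blast
    then have "(a ^^ c) ((b ^^ d) (b l)) \<in> L"
      using funpow_commute[of a b c 1, OF comm, symmetric] by (simp add: funpow_swap1)
    then show "b l \<in> L'"
      unfolding L'_def by blast
  qed
  \<comment> \<open>This is the closed span of the basis vectors with index in \<open>L'\<close>. It
    is reducing and contains \<open>\<xi> x\<close>, so irreducibility makes it the whole space and
    every vertex reaches \<open>L\<close>.\<close>
  define M where "M = {y. \<forall>l. l \<notin> L' \<longrightarrow> cinner y (\<xi> l) = 0}"
  have "reducing m n S T M"
    unfolding reducing_def coinvariant_def M_def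
    using atomic_cuntz_reducing[OF S onb s L'a] atomic_cuntz_reducing[OF T onb t L'b]
    by blast
  moreover have "csubspace M" "closed M"
    unfolding M_def using csubspace_coeffs_vanish closed_coeffs_vanish[OF onb] by auto
  ultimately have "M = {0} \<or> M = UNIV"
    using assms(5) unfolding irreducible_rep_def by blast
  moreover have "(a ^^ 0) ((b ^^ 0) x) \<in> L"
    using \<open>x \<in> L\<close> by simp
  then have "x \<in> L'"
    unfolding L'_def by blast
  then have "\<xi> x \<in> M"
    unfolding M_def by (auto simp: cinner_basis[OF onb])
  ultimately have "M = UNIV"
    using basis_neq_0[OF onb, of x] by blast
  obtain h where h: "\<eta> = \<xi> h"
    using assms(9) by blast
  have "h \<in> L'"
  proof (rule ccontr)
    assume "h \<notin> L'"
    then have "cinner (\<xi> h) (\<xi> h) = 0"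
      using \<open>M = UNIV\<close> unfolding M_def by blast
    then show False by (simp add: cinner_basis[OF onb])
  qed
  then obtain c d where cd: "(a ^^ c) ((b ^^ d) h) \<in> L"
    unfolding L'_def by blast
  \<comment> \<open>Otherwise \<open>\<eta>\<close> would lie in \<open>V\<close> and be orthogonal
    to itself.\<close>
  have "h \<notin> L"
    using assms(10) cinner_basis[OF onb, of h h] unfolding L_def h orth_complement_def by auto
  have "\<exists>z. aperiodic a b z"
    using assms(11)
  proof
    assume "\<exists>u\<in>lists {1..m}. u \<noteq> [] \<and> cinner (word_op S u \<eta>) \<eta> \<noteq> 0"
    then obtain u where u: "u \<in> lists {1..m}" "u \<noteq> []" "cinner (word_op S u (\<xi> h)) (\<xi> h) \<noteq> 0"
      using h by blast
    have "length u \<ge> 1"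
      using u(2) by (cases u) auto
    from exists_aperiodic_vertex[OF s(2) \<open>m \<ge> 2\<close> comm La Lb \<open>h \<notin> L\<close> cd this
        word_op_return[OF S onb s u(1,3)]]
    show ?thesis .
  next
    assume "\<exists>v\<in>lists {1..n}. v \<noteq> [] \<and> cinner (word_op T v \<eta>) \<eta> \<noteq> 0"
    then obtain v where v: "v \<in> lists {1..n}" "v \<noteq> []" "cinner (word_op T v (\<xi> h)) (\<xi> h) \<noteq> 0"
      using h by blast
    have "length v \<ge> 1"
      using v(2) by (cases v) auto
    \<comment> \<open>With the colours exchanged, the powers leading into \<open>L\<close> have to
      appear in the opposite order.\<close>
    moreover have "(b ^^ d) ((a ^^ c) h) \<in> L"
      using cd by (simp add: funpow_commute[of a b, OF comm])
    ultimately have "\<exists>z. aperiodic b a z"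
      using exists_aperiodic_vertex[OF t(2) \<open>n \<ge> 2\<close> comm[symmetric] Lb La \<open>h \<notin> L\<close> _ _
        word_op_return[OF T onb t v(1,3)]] by blast
    then show ?thesis
      using aperiodic_swap[of a b, OF comm] by blast
  qed
  then obtain z where z: "aperiodic a b z" ..
  have "wandering m n \<theta> S T (\<xi> z)"
    using aperiodic_vertex_words_eq[OF s(2) t(2) comm z]
    by (intro wandering_basis_vector[OF rep onb s(1) t(1) \<theta>])
  then show ?thesis by blast
qed

end
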